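(* Let $r\geq 3$ be a fixed integer. For each positive integer $m$, let $K_{r\times (r-1)m}$ be the complete $r$-partite graph with $r$ partition classes of $(r-1)m$ vertices each, and let $M=M_m$ be a balanced perfect matching in $K_{r\times (r-1)m}$. Then $$\lim_{m\to\infty}\frac{\mathrm{bpm}(K_{r\times (r-1)m}-M)}{\mathrm{bpm}(K_{r\times (r-1)m})}=e^{-r/(2r-2)}.$$
   Context: Graphs are finite and simple, with labelled vertices. The complete $r$-partite graph has as its edges exactly all pairs of vertices lying in different partition classes. A perfect matching in $K_{r\times (r-1)m}$ (or in a spanning subgraph of it, with respect to the same partition into $r$ classes) is called balanced if it has the same number of edges between each pair of distinct partition classes; this number is then necessarily $m$. $\mathrm{bpm}(G)$ denotes the number of balanced perfect matchings of $G$. For a set $M$ of edges of $G$, $G-M$ is the graph with the same vertex set and edge set $E(G)\setminus M$, with the same partition classes. Since $M$ may depend on $m$, the limit is asserted for every choice of a sequence $(M_m)_{m\ge 1}$ of balanced perfect matchings, $M_m$ in $K_{r\times(r-1)m}$. *)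

theory Defs
  imports Complex_Main
begin

text \<open>A finite simple graph is a vertex set together with a set of edges, each edge being
  the two-element set of its end vertices.\<close>

record 'a graph =
  vertices :: "'a set"
  edges :: "'a set set"

definition delete_edges :: "'a graph \<Rightarrow> 'a set set \<Rightarrow> 'a graph" where
  "delete_edges G M = \<lparr>vertices = vertices G, edges = edges G - M\<rparr>"

definition perfect_matching :: "'a graph \<Rightarrow> 'a set set \<Rightarrow> bool" where
  "perfect_matching G M \<longleftrightarrow> M \<subseteq> edges G \<and> (\<forall>v\<in>vertices G. \<exists>!e. e \<in> M \<and> v \<in> e)"

definition edges_between :: "'a set set \<Rightarrow> 'a set \<Rightarrow> 'a set \<Rightarrow> 'a set set" where
  "edges_between M A B = {e \<in> M. \<exists>u\<in>A. \<exists>v\<in>B. e = {u, v}}"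

text \<open>In the following definitions \<open>P\<close> is the set of partition classes: a family of pairwise
  disjoint sets whose union is the vertex set of the graph.\<close>

definition complete_multipartite :: "'a set set \<Rightarrow> 'a graph" where
  "complete_multipartite P =
     \<lparr>vertices = \<Union>P,
      edges = {{u, v} | u v. \<exists>A\<in>P. \<exists>B\<in>P. A \<noteq> B \<and> u \<in> A \<and> v \<in> B}\<rparr>"

definition balanced :: "'a set set \<Rightarrow> 'a set set \<Rightarrow> bool" where
  "balanced P M \<longleftrightarrow>
     (\<exists>k. \<forall>A\<in>P. \<forall>B\<in>P. A \<noteq> B \<longrightarrow> card (edges_between M A B) = k)"

definition balanced_perfect_matching :: "'a set set \<Rightarrow> 'a graph \<Rightarrow> 'a set set \<Rightarrow> bool" where
  "balanced_perfect_matching P G M \<longleftrightarrow> perfect_matching G M \<and> balanced P M"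

definition bpm :: "'a set set \<Rightarrow> 'a graph \<Rightarrow> nat" where
  "bpm P G = card {M. balanced_perfect_matching P G M}"

text \<open>The vertex \<open>(i, j)\<close> is the \<open>j\<close>-th vertex of class number \<open>i\<close>; there are \<open>r\<close> classes
  of \<open>n\<close> vertices each.\<close>

definition parts :: "nat \<Rightarrow> nat \<Rightarrow> (nat \<times> nat) set set" where
  "parts r n = (\<lambda>i. {i} \<times> {..<n}) ` {..<r}"

definition K :: "nat \<Rightarrow> nat \<Rightarrow> (nat \<times> nat) graph" where
  "K r n = complete_multipartite (parts r n)"

end

theory Submission
  imports Defs "HOL-Library.Disjoint_Sets"
begin

text \<open>
  Let \<open>N\<close> be a uniformly random balanced perfect matching, \<open>n = (r - 1) m\<close> and
  \<open>X = card (N \<inter> M)\<close>. The number of perfect matchings with prescribed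
  multiplicities \<open>c\<^sub>T\<close> between the pairs \<open>T\<close> of classes is the product of the
  factorials of the class sizes divided by the product of the \<open>c\<^sub>T!\<close>. Hence a
  \<open>k\<close>-subset \<open>S\<close> of \<open>M\<close> lies in \<open>N\<close> with probability asymptotic to
  \<open>m ^ k / n ^ (2 k)\<close>, uniformly in \<open>S\<close>. As \<open>M\<close> has \<open>(r choose 2) m\<close> edges, the
  binomial moments \<open>E (X choose k)\<close> tend to \<open>l ^ k / k!\<close> with
  \<open>l = r / (2 r - 2)\<close>, and the Bonferroni inequalities squeeze the probability of
  \<open>X = 0\<close> to \<open>exp (- l)\<close>.
\<close>

section \<open>Estimates for falling factorials\<close>

text \<open>The quotient is the falling factorial of \<open>m\<close> with \<open>s\<close> factors,
  all between \<open>m - k\<close> and \<open>m\<close>. The bound \<open>k\<close> is kept apart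
  from \<open>s\<close> so that factors with different \<open>s\<close> share one base and their
  product collapses to a single power.\<close>

lemma fact_quotient_bounds:
  assumes "s \<le> k" "k \<le> m"
  shows "(real m - real k) ^ s \<le> fact m / fact (m - s) \<and> fact m / fact (m - s) \<le> real m ^ s"
  using assms(1)
proof (induction s)
  case (Suc s)
  have "fact (m - s) = real (m - s) * fact (m - Suc s)"
    using Suc.prems assms(2) by (simp add: fact_reduce)
  then have eq: "fact m / fact (m - Suc s) = (real m - real s) * (fact m / fact (m - s) :: real)"
    using Suc.prems assms(2) by (simp add: of_nat_diff)
  have "(real m - real k) * (real m - real k) ^ s \<le> (real m - real s) * (fact m / fact (m - s))"
    using Suc assms(2) by (intro mult_mono) auto
  moreover have "(real m - real s) * (fact m / fact (m - s)) \<le> real m * real m ^ s"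
    using Suc by (intro mult_mono) auto
  ultimately show ?case unfolding eq by simp
qed simp

lemmas fact_quotient_lower = fact_quotient_bounds[THEN conjunct1]
lemmas fact_quotient_upper = fact_quotient_bounds[OF _ order.refl, THEN conjunct2]

section \<open>Perfect matchings with prescribed numbers of edges between colour classes\<close>

text \<open>The partition classes are encoded as the fibres of a fixed \<open>f\<close>. Deleting
  vertices then only shrinks the fibres, and these may become unequal or empty, as happens when
  edges are removed one at a time.\<close>

locale colouring =
  fixes f :: "'a \<Rightarrow> 'b" and I :: "'b set"
  assumes finite_I: "finite I"
begin

definition pairs :: "'b set set" where
  "pairs = {T. T \<subseteq> I \<and> card T = 2}"

definition bichromatic :: "'a set \<Rightarrow> bool" where
  "bichromatic e \<longleftrightarrow> card e = 2 \<and> card (f ` e) = 2"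

definition count_type :: "'a set set \<Rightarrow> 'b set \<Rightarrow> nat" where
  "count_type N T = card {e \<in> N. f ` e = T}"

definition colour_class :: "'a set \<Rightarrow> 'b \<Rightarrow> 'a set" where
  "colour_class V i = {v \<in> V. f v = i}"

text \<open>A perfect matching is viewed as a partition of \<open>V\<close> into bichromatic blocks.
  The multiplicities may depend on \<open>T\<close> because removing edges from a balanced matching
  destroys balance, and the count proceeds by such removals.\<close>

definition matchings :: "'a set \<Rightarrow> ('b set \<Rightarrow> nat) \<Rightarrow> 'a set set set" where
  "matchings V c = {N. partition_on V N \<and> (\<forall>e\<in>N. bichromatic e) \<and>
     (\<forall>T\<in>pairs. count_type N T = c T)}"

lemma finite_pairs: "finite pairs"
  unfolding pairs_def using finite_I by simp

lemma bichromatic_inj_on: "bichromatic e \<Longrightarrow> inj_on f e"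
  unfolding bichromatic_def by (metis card.infinite eq_card_imp_inj_on zero_neq_numeral)

lemma finite_bichromatic: "bichromatic e \<Longrightarrow> finite e"
  unfolding bichromatic_def by (metis card.infinite zero_neq_numeral)

lemma bichromatic_pair: "bichromatic {v, w} \<longleftrightarrow> f v \<noteq> f w"
  unfolding bichromatic_def by (auto simp: card_insert_if)

lemma finite_matching:
  assumes "finite V" "N \<in> matchings V c" shows "finite N"
  using assms finite_elements unfolding matchings_def by blast

lemma finite_matchings:
  assumes "finite V" shows "finite (matchings V c)"
proof (rule finite_subset)
  show "matchings V c \<subseteq> Pow (Pow V)"
    by (auto simp: matchings_def partition_on_def)
qed (use assms in simp)

text \<open>Each bichromatic edge has its type in \<open>pairs\<close>, so the types split the edges
  disjointly. The filter \<open>P\<close> covers two uses: all edges, and the edges meeting one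
  given colour.\<close>

lemma sum_count_type:
  assumes "finite N" "\<Union>N \<subseteq> V" "f ` V \<subseteq> I" "\<forall>e\<in>N. bichromatic e"
  shows "(\<Sum>T\<in>{T\<in>pairs. P T}. count_type N T) = card {e \<in> N. P (f ` e)}"
proof -
  have "{e \<in> N. P (f ` e)} = (\<Union>T\<in>{T\<in>pairs. P T}. {e \<in> N. f ` e = T})"
    using assms by (fastforce simp: pairs_def bichromatic_def)
  then show ?thesis
    unfolding count_type_def using assms finite_pairs
    by (subst card_UN_disjoint[symmetric]) auto
qed

text \<open>The degree condition that any matching imposes on \<open>c\<close>: each vertex of
  colour \<open>i\<close> lies in exactly one edge, and that edge has no other vertex of colour
  \<open>i\<close>.\<close>

lemma sum_count_type_incident:
  assumes "finite V" "f ` V \<subseteq> I" "N \<in> matchings V c"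
  shows "(\<Sum>T\<in>{T\<in>pairs. i \<in> T}. c T) = card (colour_class V i)"
proof -
  have N: "partition_on V N" "\<forall>e\<in>N. bichromatic e" "\<forall>T\<in>pairs. count_type N T = c T"
    using assms by (auto simp: matchings_def)
  have fN: "finite N" using assms finite_matching by blast
  \<comment> \<open>As \<open>f\<close> is injective on a bichromatic edge, the edge has at most one
    vertex of each colour.\<close>
  have one: "card {v\<in>e. f v = i} = (if i \<in> f ` e then 1 else 0)" if "e \<in> N" for e
  proof (cases "i \<in> f ` e")
    case True
    then obtain v where v: "v \<in> e" "f v = i" by auto
    have "{v\<in>e. f v = i} = {v}"
      using v bichromatic_inj_on[of e] N(2) that by (auto dest: inj_onD)
    then show ?thesis using True by simp
  next
    case False
    then have "{v\<in>e. f v = i} = {}" by auto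
    then show ?thesis using False by (metis card.empty)
  qed
  have "colour_class V i = (\<Union>e\<in>N. {v\<in>e. f v = i})"
    using N(1) by (auto simp: colour_class_def partition_on_def)
  also have "card \<dots> = (\<Sum>e\<in>N. card {v\<in>e. f v = i})"
  proof (rule card_UN_disjoint)
    show "\<forall>e\<in>N. finite {v \<in> e. f v = i}"
      using N(2) finite_bichromatic by auto
    show "\<forall>e\<in>N. \<forall>e'\<in>N. e \<noteq> e' \<longrightarrow> {v \<in> e. f v = i} \<inter> {v \<in> e'. f v = i} = {}"
      using N(1) by (auto simp: partition_on_def disjoint_def)
  qed (fact fN)
  also have "\<dots> = card {e \<in> N. i \<in> f ` e}"
    using one fN by (simp add: sum.If_cases Int_def)
  also have "\<dots> = (\<Sum>T\<in>{T\<in>pairs. i \<in> T}. count_type N T)"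
    using sum_count_type[of N V] fN N assms(2) by (simp add: partition_on_def)
  also have "\<dots> = (\<Sum>T\<in>{T\<in>pairs. i \<in> T}. c T)"
    using N(3) by (intro sum.cong) auto
  finally show ?thesis by simp
qed

text \<open>Removing \<open>S\<close> and adding it back are inverse bijections. The assumption
  \<open>le\<close> makes the truncated subtraction exact, so that adding \<open>S\<close> restores
  the multiplicities \<open>c\<close>.\<close>

lemma card_matchings_containing:
  assumes "finite V" "disjoint S" "\<forall>e\<in>S. bichromatic e" "\<Union>S \<subseteq> V"
    and le: "\<And>T. T \<in> pairs \<Longrightarrow> count_type S T \<le> c T"
  shows "card {N \<in> matchings V c. S \<subseteq> N} =
    card (matchings (V - \<Union>S) (\<lambda>T. c T - count_type S T))"
proof (rule bij_betw_same_card)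
  let ?c = "\<lambda>T. c T - count_type S T"
  have fS: "finite S" using assms(1,4) by (meson finite_UnionD finite_subset)
  have nempty: "e \<noteq> {}" if "bichromatic e" for e
    using that by (auto simp: bichromatic_def)
  show "bij_betw (\<lambda>N. N - S) {N \<in> matchings V c. S \<subseteq> N} (matchings (V - \<Union>S) ?c)"
  proof (rule bij_betw_byWitness[where f' = "\<lambda>N. N \<union> S"])
    show "\<forall>N\<in>{N \<in> matchings V c. S \<subseteq> N}. N - S \<union> S = N" by auto
    show "\<forall>N\<in>matchings (V - \<Union>S) ?c. N \<union> S - S = N"
    proof
      fix N assume N: "N \<in> matchings (V - \<Union>S) ?c"
      have "e \<notin> S" if "e \<in> N" for e
      proof
        assume "e \<in> S"
        moreover have "e \<subseteq> V - \<Union>S" "e \<noteq> {}"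
          using N that by (auto simp: matchings_def partition_on_def)
        ultimately show False by blast
      qed
      then show "N \<union> S - S = N" by auto
    qed
    show "(\<lambda>N. N - S) ` {N \<in> matchings V c. S \<subseteq> N} \<subseteq> matchings (V - \<Union>S) ?c"
    proof clarify
      fix N assume N: "N \<in> matchings V c" "S \<subseteq> N"
      have p: "partition_on V N" "\<forall>e\<in>N. bichromatic e" "\<forall>T\<in>pairs. count_type N T = c T"
        using N by (auto simp: matchings_def)
      have "partition_on (V - \<Union>S) (N - S)"
        unfolding partition_on_def
      proof (intro conjI)
        \<comment> \<open>Remaining edges avoid the vertices of \<open>S\<close>, since all of them
          are blocks of the one partition \<open>N\<close>.\<close>
        have "e \<inter> e' = {}" if "e \<in> N - S" "e' \<in> S" for e e'
          using disjointD[OF partition_onD2[OF p(1)], of e e'] N(2) that by auto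
        then have "\<Union>(N - S) \<inter> \<Union>S = {}" by blast
        moreover have "\<Union>(N - S) \<union> \<Union>S = V"
          using p(1) N(2) by (auto simp: partition_on_def)
        ultimately show "\<Union>(N - S) = V - \<Union>S" by blast
        show "disjoint (N - S)"
          using p(1) by (auto simp: partition_on_def disjoint_def)
        show "{} \<notin> N - S" using p(1) by (auto simp: partition_on_def)
      qed
      moreover have "count_type (N - S) T = count_type N T - count_type S T" for T
      proof -
        have "{e \<in> N - S. f ` e = T} = {e \<in> N. f ` e = T} - {e \<in> S. f ` e = T}" by auto
        then show ?thesis
          unfolding count_type_def using N(2) fS by (simp add: card_Diff_subset Collect_mono_iff subset_iff)
      qed
      ultimately show "N - S \<in> matchings (V - \<Union>S) ?c"
        using p by (auto simp: matchings_def)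
    qed
    show "(\<lambda>N. N \<union> S) ` matchings (V - \<Union>S) ?c \<subseteq> {N \<in> matchings V c. S \<subseteq> N}"
    proof clarify
      fix N assume N: "N \<in> matchings (V - \<Union>S) ?c"
      have p: "partition_on (V - \<Union>S) N" "\<forall>e\<in>N. bichromatic e"
        "\<forall>T\<in>pairs. count_type N T = ?c T"
        using N by (auto simp: matchings_def)
      have fN: "finite N" using N finite_matching assms(1) by blast
      have NS: "e \<notin> S" if "e \<in> N" for e
      proof
        assume "e \<in> S"
        moreover have "e \<subseteq> V - \<Union>S" "e \<noteq> {}"
          using p that by (auto simp: partition_on_def)
        ultimately show False by blast
      qed
      have "partition_on S' (N \<union> S)" if "S' = V" for S'
        unfolding that partition_on_def
      proof (intro conjI)
        show "\<Union>(N \<union> S) = V" using p(1) assms(4) by (auto simp: partition_on_def)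
        show "disjoint (N \<union> S)"
          using p(1) assms(2) by (intro disjoint_union) (auto simp: partition_on_def)
        show "{} \<notin> N \<union> S" using p(2) assms(3) nempty by blast
      qed
      moreover have "count_type (N \<union> S) T = c T" if "T \<in> pairs" for T
      proof -
        have "{e \<in> N \<union> S. f ` e = T} = {e \<in> N. f ` e = T} \<union> {e \<in> S. f ` e = T}" by auto
        then have "count_type (N \<union> S) T = count_type N T + count_type S T"
          unfolding count_type_def using fN fS NS by (simp add: card_Un_disjoint disjoint_iff)
        then show ?thesis using p(3) le that by simp
      qed
      ultimately show "N \<union> S \<in> matchings V c \<and> S \<subseteq> N \<union> S"
        using p assms(3) by (auto simp: matchings_def)
    qed
  qed
qed

section \<open>The exact number of matchings\<close>

lemma bij_betw_incident_pairs:
  assumes "i \<in> I"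
  shows "bij_betw (\<lambda>j. {i, j}) (I - {i}) {T\<in>pairs. i \<in> T}"
  unfolding bij_betw_def
proof
  show "inj_on (\<lambda>j. {i, j}) (I - {i})"
    by (auto simp: inj_on_def doubleton_eq_iff)
  show "(\<lambda>j. {i, j}) ` (I - {i}) = {T \<in> pairs. i \<in> T}"
    using assms by (auto simp: pairs_def card_2_iff card_insert_if)
qed

lemma count_type_singleton: "count_type {e} T = (if T = f ` e then 1 else 0)"
proof -
  have "{e' \<in> {e}. f ` e' = T} = (if T = f ` e then {e} else {})" by auto
  then show ?thesis by (simp add: count_type_def)
qed

text \<open>Sum over the partner \<open>w\<close> of a fixed vertex \<open>v\<close>: removing the edge \<open>{v, w}\<close> divides the
  product of factorials of the class sizes by the sizes of the two classes, and that of the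
  multiplicities by the multiplicity of the pair of colours.\<close>

lemma card_matchings:
  assumes "finite V" "f ` V \<subseteq> I"
    and "\<And>i. i \<in> I \<Longrightarrow> (\<Sum>T\<in>{T\<in>pairs. i \<in> T}. c T) = card (colour_class V i)"
  shows "real (card (matchings V c)) * (\<Prod>T\<in>pairs. fact (c T)) =
    (\<Prod>i\<in>I. fact (card (colour_class V i)))"
  using assms
proof (induction V arbitrary: c rule: finite_psubset_induct)
  case (psubset V)
  \<comment> \<open>The degree condition bounds each multiplicity by the size of both classes
    involved, so an empty class forces multiplicity 0. Both degenerate cases below rest on
    this.\<close>
  have c_le: "c T \<le> card (colour_class V i)" if "T \<in> pairs" "i \<in> T" for T i
  proof -
    have "c T \<le> (\<Sum>T\<in>{T\<in>pairs. i \<in> T}. c T)"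
      using that finite_pairs by (intro member_le_sum) auto
    then show ?thesis using psubset.prems(2)[of i] that by (auto simp: pairs_def)
  qed
  show ?case
  proof (cases "V = {}")
    case True
    have "c T = 0" if T: "T \<in> pairs" for T
    proof -
      from T obtain i where "i \<in> T" by (auto simp: pairs_def card_2_iff)
      then show ?thesis using c_le[OF T] True by (simp add: colour_class_def)
    qed
    moreover from this have "matchings V c = {{}}"
      using True by (auto simp: matchings_def count_type_def partition_on_empty)
    ultimately show ?thesis using True by (simp add: colour_class_def)
  next
    case False
    then obtain v where v: "v \<in> V" by auto
    define i where "i = f v"
    define a where "a = (\<lambda>j. card (colour_class V j))"
    define Q :: real where "Q = (\<Prod>i\<in>I. fact (a i))"
    define R :: real where "R = (\<Prod>T\<in>pairs. fact (c T))"
    define W where "W = {w \<in> V. f w \<noteq> i}"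
    have iI: "i \<in> I" using v psubset.prems(1) by (auto simp: i_def)
    have fcc: "finite (colour_class U j)" if "U \<subseteq> V" for U j
      using psubset.hyps that by (auto simp: colour_class_def intro: finite_subset)
    have a_pos: "a (f u) > 0" if "u \<in> V" for u
      using that fcc[of V "f u"] by (auto simp: a_def card_gt_0_iff colour_class_def)
    have finW: "finite W" using psubset.hyps by (simp add: W_def)
    have part: "real (card {N \<in> matchings V c. {v, w} \<in> N}) * R =
        Q * (c {i, f w} / (a i * a (f w)))" if w: "w \<in> W" for w
    proof -
      define T0 where "T0 = {i, f w}"
      have T0: "T0 \<in> pairs" "f ` {v, w} = T0"
        using w iI psubset.prems(1) by (auto simp: T0_def pairs_def W_def i_def card_insert_if)
      have bi: "bichromatic {v, w}" using w by (auto simp: bichromatic_pair W_def i_def)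
      show ?thesis
      proof (cases "c T0 = 0")
        \<comment> \<open>No matching can use an edge of type \<open>T0\<close>, so both sides
          vanish. In the other case \<open>c T0 - 1\<close> is a genuine predecessor.\<close>
        case True
        have "{v, w} \<notin> N" if N: "N \<in> matchings V c" for N
        proof
          assume vw: "{v, w} \<in> N"
          have "finite N" using N finite_matching psubset.hyps by blast
          then have "count_type N T0 > 0"
            using T0(2) vw by (auto simp: count_type_def card_gt_0_iff)
          then show False using N True T0(1) by (auto simp: matchings_def)
        qed
        then have "{N \<in> matchings V c. {v, w} \<in> N} = {}" by blast
        then show ?thesis using True by (simp only: T0_def) simp
      next
        case False
        define V' where "V' = V - {v, w}"
        define c' where "c' = (\<lambda>T. c T - count_type {{v, w}} T)"
        have c': "c' T = (if T = T0 then c T - 1 else c T)" for T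
          using T0(2) by (simp add: c'_def count_type_singleton)
        have wV: "w \<in> V" "f w \<noteq> i" using w by (auto simp: W_def)
        have a': "card (colour_class V' l) = (if l \<in> T0 then a l - 1 else a l)" for l
        proof -
          have "colour_class V' l = colour_class V l -
              (if l = i then {v} else if l = f w then {w} else {})"
            using wV by (auto simp: V'_def colour_class_def i_def)
          then show ?thesis
            using fcc[of V l] v wV by (auto simp: a_def T0_def i_def colour_class_def)
        qed
        \<comment> \<open>The smaller instance inherits the degree condition: at the two colours of
          \<open>T0\<close> both sides drop by one, elsewhere nothing changes.\<close>
        have sum': "(\<Sum>T\<in>{T\<in>pairs. l \<in> T}. c' T) = card (colour_class V' l)" if l: "l \<in> I" for l
        proof (cases "l \<in> T0")
          case True
          have "T0 \<in> {T\<in>pairs. l \<in> T}" using True T0 by simp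
          then have "(\<Sum>T\<in>{T\<in>pairs. l \<in> T}. c' T) + 1 = (\<Sum>T\<in>{T\<in>pairs. l \<in> T}. c T)"
            using finite_pairs \<open>c T0 \<noteq> 0\<close>
            by (simp add: sum.remove[of _ T0] c' del: mem_Collect_eq)
          then show ?thesis using True psubset.prems(2)[OF l] a'[of l] by (simp add: a_def)
        next
          case False
          then have "(\<Sum>T\<in>{T\<in>pairs. l \<in> T}. c' T) = (\<Sum>T\<in>{T\<in>pairs. l \<in> T}. c T)"
            by (intro sum.cong) (auto simp: c')
          then show ?thesis using False psubset.prems(2)[OF l] a'[of l] by (simp add: a_def)
        qed
        have "card {N \<in> matchings V c. {{v, w}} \<subseteq> N} = card (matchings (V - \<Union>{{v, w}}) c')"
          unfolding c'_def using psubset.hyps bi v wV T0 False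
          by (intro card_matchings_containing) (auto simp: count_type_singleton)
        then have card_eq: "card {N \<in> matchings V c. {v, w} \<in> N} = card (matchings V' c')"
          by (simp add: V'_def)
        have IH: "real (card (matchings V' c')) * (\<Prod>T\<in>pairs. fact (c' T)) =
            (\<Prod>i\<in>I. fact (card (colour_class V' i)))"
          using psubset.prems(1) v sum' by (intro psubset.IH) (auto simp: V'_def)
        \<comment> \<open>Only the factor at \<open>T0\<close> changes, from the factorial of
          \<open>c T0\<close> to that of \<open>c T0 - 1\<close>.\<close>
        have R: "R = c T0 * (\<Prod>T\<in>pairs. fact (c' T))"
        proof -
          have "R = fact (c T0) * (\<Prod>T\<in>pairs - {T0}. fact (c' T))"
            unfolding R_def using finite_pairs T0(1) by (simp add: prod.remove c')
          also have "fact (c T0) = real (c T0) * fact (c' T0)"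
            using False by (simp add: c' fact_reduce)
          finally show ?thesis using finite_pairs T0(1) by (simp add: prod.remove)
        qed
        \<comment> \<open>Exactly two classes lose a vertex, those of \<open>v\<close> and
          \<open>w\<close>, and they are different classes.\<close>
        have Q: "Q = real (a i * a (f w)) * (\<Prod>i\<in>I. fact (card (colour_class V' i)))"
        proof -
          have "Q = (\<Prod>l\<in>I. (if l \<in> T0 then real (a l) else 1) * fact (card (colour_class V' l)))"
            unfolding Q_def
          proof (rule prod.cong)
            fix l assume "l \<in> I"
            show "fact (a l) = (if l \<in> T0 then real (a l) else 1) * fact (card (colour_class V' l))"
              using a_pos[OF v] a_pos[OF wV(1)]
              by (auto simp: a' T0_def i_def fact_reduce)
          qed simp
          also have "\<dots> = (\<Prod>l\<in>I. if l \<in> T0 then real (a l) else 1) *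
              (\<Prod>i\<in>I. fact (card (colour_class V' i)))"
            by (rule prod.distrib)
          also have "(\<Prod>l\<in>I. if l \<in> T0 then real (a l) else 1) = (\<Prod>l\<in>T0. real (a l))"
          proof -
            have "I \<inter> T0 = T0" using T0(1) by (auto simp: pairs_def)
            then show ?thesis
              using prod.inter_restrict[OF finite_I, of "\<lambda>l. real (a l)" T0] by simp
          qed
          also have "\<dots> = a i * a (f w)" using wV by (simp add: T0_def)
          finally show ?thesis .
        qed
        show ?thesis
          using IH R Q a_pos[OF v] a_pos[OF wV(1)] by (simp add: card_eq T0_def i_def)
      qed
    qed
    \<comment> \<open>Classify the matchings by the partner of \<open>v\<close>, which exists and is
      unique.\<close>
    have "matchings V c = (\<Union>w\<in>W. {N \<in> matchings V c. {v, w} \<in> N})"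
    proof -
      have "\<exists>w\<in>W. {v, w} \<in> N" if N: "N \<in> matchings V c" for N
      proof -
        obtain e where e: "e \<in> N" "v \<in> e" "e \<subseteq> V"
          using N v by (auto simp: matchings_def partition_on_def)
        have b: "bichromatic e" using N e by (auto simp: matchings_def)
        then obtain w where w: "e = {v, w}"
          using e(2) by (auto simp: bichromatic_def card_2_iff)
        then show ?thesis using e b by (auto simp: W_def bichromatic_pair i_def)
      qed
      then show ?thesis by auto
    qed
    also have "card \<dots> = (\<Sum>w\<in>W. card {N \<in> matchings V c. {v, w} \<in> N})"
    proof (rule card_UN_disjoint[OF finW])
      show "\<forall>w\<in>W. finite {N \<in> matchings V c. {v, w} \<in> N}"
        using finite_matchings psubset.hyps by simp
      show "\<forall>w\<in>W. \<forall>w'\<in>W. w \<noteq> w' \<longrightarrow>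
        {N \<in> matchings V c. {v, w} \<in> N} \<inter> {N \<in> matchings V c. {v, w'} \<in> N} = {}"
      proof (intro ballI impI equals0I)
        fix w w' N assume "w \<noteq> w'"
          and "N \<in> {N \<in> matchings V c. {v, w} \<in> N} \<inter> {N \<in> matchings V c. {v, w'} \<in> N}"
        then have "disjoint N" "{v, w} \<in> N" "{v, w'} \<in> N" "{v, w} \<noteq> {v, w'}"
          by (auto simp: matchings_def partition_on_def doubleton_eq_iff)
        then show False using disjointD by fastforce
      qed
    qed
    finally have "real (card (matchings V c)) * R =
        (\<Sum>w\<in>W. real (card {N \<in> matchings V c. {v, w} \<in> N}) * R)"
      by (simp add: sum_distrib_right)
    also have "\<dots> = (\<Sum>w\<in>W. Q * (c {i, f w} / (a i * a (f w))))"
      using part by (intro sum.cong) auto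
    also have "\<dots> = Q / a i * (\<Sum>w\<in>W. c {i, f w} / a (f w))"
      by (simp add: sum_distrib_left)
    \<comment> \<open>Group the partners by colour: the \<open>a j\<close> vertices of colour
      \<open>j\<close> contribute equally, together \<open>c {i, j}\<close>, and by the degree
      condition these multiplicities add up to \<open>a i\<close>.\<close>
    also have "(\<Sum>w\<in>W. c {i, f w} / a (f w)) =
        (\<Sum>j\<in>I - {i}. \<Sum>w\<in>{w\<in>W. f w = j}. c {i, f w} / a (f w))"
      using finW finite_I psubset.prems(1)
      by (intro sum.group[symmetric]) (auto simp: W_def)
    also have "\<dots> = (\<Sum>j\<in>I - {i}. real (c {i, j}))"
    proof (rule sum.cong)
      fix j assume j: "j \<in> I - {i}"
      have "{w\<in>W. f w = j} = colour_class V j" using j by (auto simp: W_def colour_class_def)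
      then have "(\<Sum>w\<in>{w\<in>W. f w = j}. c {i, f w} / a (f w)) = a j * (c {i, j} / a j)"
        by (simp add: a_def colour_class_def)
      also have "\<dots> = c {i, j}"
      proof (cases "a j = 0")
        \<comment> \<open>Division by zero yields 0, which is the right value because an empty class
          forces \<open>c {i, j} = 0\<close>.\<close>
        case True
        have "{i, j} \<in> pairs" using j iI by (auto simp: pairs_def card_insert_if)
        then have "c {i, j} = 0" using c_le[of "{i, j}" j] True by (simp add: a_def)
        then show ?thesis by simp
      qed simp
      finally show "(\<Sum>w\<in>{w\<in>W. f w = j}. c {i, f w} / a (f w)) = c {i, j}" .
    qed simp
    also have "\<dots> = a i"
      using sum.reindex_bij_betw[OF bij_betw_incident_pairs[OF iI], of c] psubset.prems(2)[OF iI]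
      by (simp add: a_def flip: of_nat_sum)
    also have "Q / a i * a i = Q"
      using a_pos[OF v] by (simp add: i_def)
    finally show ?thesis by (simp add: Q_def R_def a_def)
  qed
qed

section \<open>Probability of containing a given set of edges\<close>

lemma card_pairs: "card pairs = card I choose 2"
  unfolding pairs_def using n_subsets[OF finite_I] by simp

text \<open>Double counting: each pair is met once from each of its two colours.\<close>

lemma sum_incident_pairs:
  fixes g :: "'b set \<Rightarrow> nat"
  shows "(\<Sum>i\<in>I. \<Sum>T\<in>{T\<in>pairs. i \<in> T}. g T) = 2 * (\<Sum>T\<in>pairs. g T)"
proof -
  have "(\<Sum>i\<in>I. \<Sum>T\<in>{T\<in>pairs. i \<in> T}. g T) = (\<Sum>T\<in>pairs. \<Sum>i\<in>{i\<in>I. i \<in> T}. g T)"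
    using finite_I finite_pairs by (rule sum.swap_restrict)
  also have "\<dots> = (\<Sum>T\<in>pairs. 2 * g T)"
  proof (rule sum.cong)
    fix T assume T: "T \<in> pairs"
    then have "{i\<in>I. i \<in> T} = T" by (auto simp: pairs_def)
    then show "(\<Sum>i\<in>{i\<in>I. i \<in> T}. g T) = 2 * g T" using T by (simp add: pairs_def)
  qed simp
  finally show ?thesis by (simp add: sum_distrib_left)
qed

text \<open>By the exact count, \<open>P\<close> is a quotient of products of falling factorials:
  those of \<open>m\<close> have \<open>k\<close> factors in total, one per edge of
  \<open>S\<close>, and those of \<open>n\<close> have \<open>2 * k\<close>, one per covered vertex.
  The bounds therefore do not depend on how \<open>S\<close> is spread over the types.\<close>

lemma prob_containing_bounds:
  assumes V: "finite V" "f ` V \<subseteq> I"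
    and M: "M \<in> matchings V (\<lambda>_. m)"
    and n: "\<And>i. i \<in> I \<Longrightarrow> card (colour_class V i) = n"
    and S: "S \<subseteq> M" "card S = k" and k: "k \<le> m" "k < n"
  defines "P \<equiv> real (card {N \<in> matchings V (\<lambda>_. m). S \<subseteq> N}) / real (card (matchings V (\<lambda>_. m)))"
  shows "(real m - real k) ^ k / real n ^ (2 * k) \<le> P"
    and "P \<le> real m ^ k / (real n - real k) ^ (2 * k)"
proof -
  \<comment> \<open>\<open>s T\<close> counts the edges of \<open>S\<close> of type
    \<open>T\<close>, and \<open>t i\<close> the vertices of colour \<open>i\<close> that
    \<open>S\<close> covers.\<close>
  define s where "s = count_type S"
  define t where "t i = (\<Sum>T\<in>{T\<in>pairs. i \<in> T}. s T)" for i
  have pM: "partition_on V M" "\<forall>e\<in>M. bichromatic e" "\<forall>T\<in>pairs. count_type M T = m"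
    using M by (auto simp: matchings_def)
  have fM: "finite M" using M finite_matching V(1) by blast
  then have fS: "finite S" using S(1) finite_subset by blast
  have SV: "\<Union>S \<subseteq> V" using pM(1) S(1) by (auto simp: partition_on_def)
  have dS: "disjoint S" using partition_onD2[OF pM(1)] S(1) by (rule pairwise_subset)
  have bS: "\<forall>e\<in>S. bichromatic e" using pM(2) S(1) by blast
  have sum_s: "(\<Sum>T\<in>pairs. s T) = k"
    using sum_count_type[of S V "\<lambda>_. True"] fS SV V(2) bS S(2) by (simp add: s_def)
  have s_m: "s T \<le> m" if "T \<in> pairs" for T
  proof -
    have "s T \<le> count_type M T"
      unfolding s_def count_type_def using fM S(1) by (intro card_mono) auto
    then show ?thesis using pM(3) that by simp
  qed
  have s_k: "s T \<le> k" if "T \<in> pairs" for T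
    using member_le_sum[of T pairs s] that finite_pairs sum_s by simp
  have t_k: "t i \<le> k" for i
    unfolding t_def sum_s[symmetric] using finite_pairs by (intro sum_mono2) auto
  have sum_t: "(\<Sum>i\<in>I. t i) = 2 * k"
    unfolding t_def sum_incident_pairs sum_s ..
  let ?A = "matchings (V - \<Union>S) (\<lambda>T. m - s T)"
  have cardA: "card {N \<in> matchings V (\<lambda>_. m). S \<subseteq> N} = card ?A"
    unfolding s_def using V dS bS SV s_m by (intro card_matchings_containing) (auto simp: s_def)
  \<comment> \<open>\<open>M\<close> itself extends \<open>S\<close>, so the residual instance has a
    matching. Its existence yields the residual degree condition and class sizes without computing
    the classes from \<open>S\<close>.\<close>
  have M_in: "M \<in> {N \<in> matchings V (\<lambda>_. m). S \<subseteq> N}" using M S(1) by simp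
  then have "card {N \<in> matchings V (\<lambda>_. m). S \<subseteq> N} > 0"
    using finite_matchings[OF V(1)] by (auto simp: card_gt_0_iff)
  then have "?A \<noteq> {}" using cardA by (metis card.empty less_irrefl)
  then obtain N where N: "N \<in> ?A" by blast
  have class_A: "card (colour_class (V - \<Union>S) i) = n - t i"
    and sum_A: "(\<Sum>T\<in>{T\<in>pairs. i \<in> T}. m - s T) = card (colour_class (V - \<Union>S) i)"
    if i: "i \<in> I" for i
  proof -
    show *: "(\<Sum>T\<in>{T\<in>pairs. i \<in> T}. m - s T) = card (colour_class (V - \<Union>S) i)"
      using N V by (intro sum_count_type_incident[where N = N]) auto
    have "n = (\<Sum>T\<in>{T\<in>pairs. i \<in> T}. m)"
      using sum_count_type_incident[OF V M] n[OF i] by simp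
    moreover have "(\<Sum>T\<in>{T\<in>pairs. i \<in> T}. m - s T) = (\<Sum>T\<in>{T\<in>pairs. i \<in> T}. m) - t i"
      unfolding t_def using s_m by (intro sum_subtractf_nat) auto
    ultimately show "card (colour_class (V - \<Union>S) i) = n - t i"
      by (simp only: *[symmetric])
  qed
  have "real (card ?A) * (\<Prod>T\<in>pairs. fact (m - s T)) =
      (\<Prod>i\<in>I. fact (card (colour_class (V - \<Union>S) i)))"
    using V sum_A by (intro card_matchings) auto
  then have A: "real (card ?A) * (\<Prod>T\<in>pairs. fact (m - s T)) = (\<Prod>i\<in>I. fact (n - t i))"
    using class_A by simp
  have "real (card (matchings V (\<lambda>_. m))) * (\<Prod>T\<in>pairs. fact m) =
      (\<Prod>i\<in>I. fact (card (colour_class V i)))"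
    using V sum_count_type_incident[OF V M] by (intro card_matchings) auto
  then have B: "real (card (matchings V (\<lambda>_. m))) * (\<Prod>T\<in>pairs. fact m) = (\<Prod>i\<in>I. fact n)"
    using n by simp
  \<comment> \<open>The multiplicities enter the count in the denominator and the class sizes in the
    numerator, hence \<open>P = X / Y\<close> and not its inverse.\<close>
  define X :: real where "X = (\<Prod>T\<in>pairs. fact m / fact (m - s T))"
  define Y :: real where "Y = (\<Prod>i\<in>I. fact n / fact (n - t i))"
  have P: "P = X / Y"
  proof -
    have nz: "(\<Prod>T\<in>pairs. fact (m - s T)) \<noteq> (0::real)" "(\<Prod>T\<in>pairs. fact m) \<noteq> (0::real)"
      "(\<Prod>i\<in>I. fact n) \<noteq> (0::real)" "(\<Prod>i\<in>I. fact (n - t i)) \<noteq> (0::real)"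
      using finite_pairs finite_I by auto
    have "P = ((\<Prod>i\<in>I. fact (n - t i)) / (\<Prod>T\<in>pairs. fact (m - s T))) /
        ((\<Prod>i\<in>I. fact n) / (\<Prod>T\<in>pairs. fact m))"
      unfolding P_def cardA A[symmetric] B[symmetric] using nz by simp
    then show ?thesis by (simp add: X_def Y_def prod_dividef)
  qed
  \<comment> \<open>All factors are estimated with the same base, and the exponents
    \<open>s T\<close> add up to \<open>k\<close>. The same works for \<open>Y\<close>, where the
    \<open>t i\<close> add up to \<open>2 * k\<close>.\<close>
  have X1: "(real m - real k) ^ k \<le> X"
  proof -
    have "(\<Prod>T\<in>pairs. (real m - real k) ^ s T) \<le> X" unfolding X_def
      using s_k k(1) by (intro prod_mono) (auto intro: fact_quotient_lower)
    then show ?thesis by (simp add: sum_s flip: power_sum)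
  qed
  have X2: "X \<le> real m ^ k"
  proof -
    have "X \<le> (\<Prod>T\<in>pairs. real m ^ s T)" unfolding X_def
      using s_m by (intro prod_mono) (auto intro: fact_quotient_upper)
    then show ?thesis by (simp add: sum_s flip: power_sum)
  qed
  have Y1: "(real n - real k) ^ (2 * k) \<le> Y"
  proof -
    have "(\<Prod>i\<in>I. (real n - real k) ^ t i) \<le> Y" unfolding Y_def
      using t_k k(2) by (intro prod_mono) (auto intro: fact_quotient_lower)
    then show ?thesis by (simp only: sum_t flip: power_sum)
  qed
  have Y2: "Y \<le> real n ^ (2 * k)"
  proof -
    have "t i \<le> n" for i using t_k[of i] k(2) by simp
    then have "Y \<le> (\<Prod>i\<in>I. real n ^ t i)" unfolding Y_def
      by (intro prod_mono) (auto intro: fact_quotient_upper)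
    then show ?thesis by (simp only: sum_t flip: power_sum)
  qed
  have Y0: "(real n - real k) ^ (2 * k) > 0" using k(2) by simp
  have X0: "(real m - real k) ^ k \<ge> 0" using k(1) by simp
  show "(real m - real k) ^ k / real n ^ (2 * k) \<le> P"
    unfolding P using X0 X1 Y0 Y1 Y2 by (intro frac_le) auto
  show "P \<le> real m ^ k / (real n - real k) ^ (2 * k)"
    unfolding P using X0 X1 X2 Y0 Y1 by (intro frac_le) auto
qed

end

section \<open>Binomial moments and the Bonferroni sieve\<close>

text \<open>Double counting of the pairs \<open>(S, N)\<close> with \<open>S\<close> a
  \<open>k\<close>-subset of \<open>N \<inter> M\<close>. It turns binomial moments into
  probabilities of containing a fixed \<open>S\<close>.\<close>

lemma sum_binomial_Int:
  fixes F :: "'a set set"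
  assumes "finite F" "finite M"
  shows "(\<Sum>N\<in>F. card (N \<inter> M) choose k) = (\<Sum>S\<in>{S. S \<subseteq> M \<and> card S = k}. card {N \<in> F. S \<subseteq> N})"
proof -
  have "(\<Sum>N\<in>F. card (N \<inter> M) choose k) = (\<Sum>N\<in>F. card {S\<in>{S. S \<subseteq> M \<and> card S = k}. S \<subseteq> N})"
  proof (rule sum.cong)
    fix N
    have "{S\<in>{S. S \<subseteq> M \<and> card S = k}. S \<subseteq> N} = {S. S \<subseteq> N \<inter> M \<and> card S = k}" by auto
    then show "card (N \<inter> M) choose k = card {S\<in>{S. S \<subseteq> M \<and> card S = k}. S \<subseteq> N}"
      using assms n_subsets[of "N \<inter> M" k] by simp
  qed simp
  also have "\<dots> = (\<Sum>S\<in>{S. S \<subseteq> M \<and> card S = k}. card {N \<in> F. S \<subseteq> N})"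
    unfolding card_eq_sum using assms by (intro sum.swap_restrict) auto
  finally show ?thesis .
qed

text \<open>The closed form shows that for positive \<open>x\<close> the truncated sum has the sign
  of \<open>(- 1) ^ L\<close> or vanishes. The case \<open>x = 0\<close> is treated separately,
  since there \<open>x - 1\<close> would be truncated to 0.\<close>

lemma alternating_binomial_sum:
  assumes "x > 0"
  shows "(\<Sum>k\<le>L. (- 1) ^ k * real (x choose k)) = (- 1) ^ L * real ((x - 1) choose L)"
  using gbinomial_sum_lower_neg[of "real x" L] assms
  by (simp add: binomial_gbinomial of_nat_diff mult.commute)

lemma alternating_binomial_sum_0: "(\<Sum>k\<le>L. (- 1) ^ k * real (0 choose k)) = 1"
  by (subst sum.remove[of _ 0]) (auto intro!: sum.neutral simp: binomial_eq_0_iff)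

text \<open>The inequalities hold pointwise in \<open>N\<close>: the truncated sum is 1 where
  \<open>X N = 0\<close>, and elsewhere it is nonnegative for even \<open>L\<close> and nonpositive
  for odd \<open>L\<close>.\<close>

lemma bonferroni:
  fixes X :: "'a \<Rightarrow> nat"
  assumes "finite F"
  shows "even L \<Longrightarrow> real (card {N\<in>F. X N = 0}) \<le> (\<Sum>k\<le>L. (- 1) ^ k * (\<Sum>N\<in>F. real (X N choose k)))"
    and "odd L \<Longrightarrow> real (card {N\<in>F. X N = 0}) \<ge> (\<Sum>k\<le>L. (- 1) ^ k * (\<Sum>N\<in>F. real (X N choose k)))"
proof -
  have swap: "(\<Sum>k\<le>L. (- 1) ^ k * (\<Sum>N\<in>F. real (X N choose k))) =
      (\<Sum>N\<in>F. \<Sum>k\<le>L. (- 1) ^ k * real (X N choose k))"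
    unfolding sum_distrib_left by (rule sum.swap)
  have card: "real (card {N\<in>F. X N = 0}) = (\<Sum>N\<in>F. if X N = 0 then 1 else 0)"
    using assms by (simp add: sum.If_cases Int_def)
  show "real (card {N\<in>F. X N = 0}) \<le> (\<Sum>k\<le>L. (- 1) ^ k * (\<Sum>N\<in>F. real (X N choose k)))" if "even L"
    unfolding swap card using that
    by (intro sum_mono) (auto simp: alternating_binomial_sum alternating_binomial_sum_0)
  show "real (card {N\<in>F. X N = 0}) \<ge> (\<Sum>k\<le>L. (- 1) ^ k * (\<Sum>N\<in>F. real (X N choose k)))" if "odd L"
    unfolding swap card using that
    by (intro sum_mono) (auto simp: alternating_binomial_sum alternating_binomial_sum_0)
qed

text \<open>The order of limits matters: \<open>L\<close> is fixed while \<open>m\<close> grows, so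
  convergence of each single moment suffices, and only then is \<open>L\<close> taken large enough
  for the exponential series.\<close>

lemma tendsto_exp_minus_sieve:
  fixes p :: "nat \<Rightarrow> real" and b :: "nat \<Rightarrow> nat \<Rightarrow> real"
  assumes b: "\<And>k. (\<lambda>m. b k m) \<longlonglongrightarrow> l ^ k / fact k"
    and upper: "\<And>L. even L \<Longrightarrow> eventually (\<lambda>m. p m \<le> (\<Sum>k\<le>L. (- 1) ^ k * b k m)) sequentially"
    and lower: "\<And>L. odd L \<Longrightarrow> eventually (\<lambda>m. p m \<ge> (\<Sum>k\<le>L. (- 1) ^ k * b k m)) sequentially"
  shows "p \<longlonglongrightarrow> exp (- l)"
proof -
  define E where "E L = (\<Sum>k\<le>L. (- 1) ^ k * (l ^ k / fact k))" for L :: nat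
  have "(\<lambda>k. (- l) ^ k / fact k) sums exp (- l)"
    using exp_converges[of "- l"] by (simp add: divide_inverse mult.commute)
  then have E: "E \<longlonglongrightarrow> exp (- l)"
    unfolding E_def sums_def_le by (simp add: power_minus[of l])
  have bE: "(\<lambda>m. \<Sum>k\<le>L. (- 1) ^ k * b k m) \<longlonglongrightarrow> E L" for L
    unfolding E_def by (intro tendsto_intros b)
  show ?thesis
  proof (rule order_tendstoI)
    fix a assume "a < exp (- l)"
    with E have "eventually (\<lambda>L. a < E L) sequentially" by (rule order_tendstoD)
    then obtain L0 where "\<And>L. L \<ge> L0 \<Longrightarrow> a < E L" by (auto simp: eventually_sequentially)
    \<comment> \<open>\<open>2 * L0 + 1\<close> is an odd index beyond the threshold, as a lower
      bound requires; \<open>2 * L0\<close> serves as the even one for the upper bound.\<close>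
    then have "a < E (2 * L0 + 1)" by simp
    with bE have "eventually (\<lambda>m. a < (\<Sum>k\<le>2 * L0 + 1. (- 1) ^ k * b k m)) sequentially"
      by (rule order_tendstoD)
    moreover have "odd (2 * L0 + 1)" by simp
    from lower[OF this]
    have "eventually (\<lambda>m. (\<Sum>k\<le>2 * L0 + 1. (- 1) ^ k * b k m) \<le> p m) sequentially" .
    ultimately show "eventually (\<lambda>m. a < p m) sequentially"
      by eventually_elim (rule less_le_trans)
  next
    fix a assume "exp (- l) < a"
    with E have "eventually (\<lambda>L. E L < a) sequentially" by (rule order_tendstoD)
    then obtain L0 where "\<And>L. L \<ge> L0 \<Longrightarrow> E L < a" by (auto simp: eventually_sequentially)
    then have "E (2 * L0) < a" by simp
    with bE have "eventually (\<lambda>m. (\<Sum>k\<le>2 * L0. (- 1) ^ k * b k m) < a) sequentially"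
      by (rule order_tendstoD)
    moreover have "even (2 * L0)" by simp
    from upper[OF this]
    have "eventually (\<lambda>m. p m \<le> (\<Sum>k\<le>2 * L0. (- 1) ^ k * b k m)) sequentially" .
    ultimately show "eventually (\<lambda>m. p m < a) sequentially"
      by eventually_elim (rule le_less_trans)
  qed
qed

text \<open>The binomial is a product of \<open>k\<close> linear factors over \<open>fact k\<close>.
  Dividing each factor by \<open>m\<close> leaves \<open>a - i / m\<close>, which tends to
  \<open>a\<close>.\<close>

lemma binomial_over_power_tendsto:
  "(\<lambda>m. real ((a * m) choose k) / real m ^ k) \<longlonglongrightarrow> real a ^ k / fact k"
proof -
  have "(\<lambda>m. (\<Prod>i<k. (real a - real i / real m)) / fact k) \<longlonglongrightarrow> (\<Prod>i<k. (real a - 0)) / fact k"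
    by (intro tendsto_intros lim_const_over_n) auto
  moreover have "eventually (\<lambda>m. (\<Prod>i<k. (real a - real i / real m)) / fact k =
      real ((a * m) choose k) / real m ^ k) sequentially"
    using eventually_gt_at_top[of 0]
  proof eventually_elim
    case (elim m)
    have "real m ^ k = (\<Prod>i<k. real m)" by simp
    then have "(\<Prod>i<k. (real a - real i / real m)) = (\<Prod>i<k. real (a * m) - real i) / real m ^ k"
      using elim by (simp only: prod_dividef[symmetric]) (simp add: field_simps)
    then show ?case
      by (simp add: binomial_gbinomial gbinomial_prod_rev atLeast0LessThan)
  qed
  ultimately show ?thesis by (auto intro: Lim_transform_eventually)
qed

section \<open>Balanced perfect matchings as matchings with constant multiplicities\<close>

lemma partition_on_iff_ex1:
  assumes "\<Union>N \<subseteq> V" "{} \<notin> N"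
  shows "partition_on V N \<longleftrightarrow> (\<forall>v\<in>V. \<exists>!e. e \<in> N \<and> v \<in> e)"
proof
  assume p: "partition_on V N"
  show "\<forall>v\<in>V. \<exists>!e. e \<in> N \<and> v \<in> e"
  proof
    fix v assume "v \<in> V"
    then obtain e where e: "e \<in> N" "v \<in> e" using p by (auto simp: partition_on_def)
    moreover have "e' = e" if "e' \<in> N" "v \<in> e'" for e'
      using disjointD[OF partition_onD2[OF p], of e e'] e that by auto
    ultimately show "\<exists>!e. e \<in> N \<and> v \<in> e" by blast
  qed
next
  assume ex1: "\<forall>v\<in>V. \<exists>!e. e \<in> N \<and> v \<in> e"
  show "partition_on V N"
    unfolding partition_on_def
  proof (intro conjI)
    show "\<Union>N = V" using assms(1) ex1 by blast
    show "disjoint N"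
    proof (rule disjointI)
      fix e e' assume "e \<in> N" "e' \<in> N" "e \<noteq> e'"
      then show "e \<inter> e' = {}" using assms(1) ex1 by blast
    qed
  qed (fact assms(2))
qed

text \<open>Here \<open>M\<close> is an arbitrary set, so that the empty set gives the count for the
  full graph too. The common multiplicity, only existential in \<open>balanced\<close>, is forced to
  be \<open>m\<close> by the class size.\<close>

lemma balanced_matchings_eq:
  fixes r m :: nat
  assumes "r \<ge> 2" "m \<ge> 1"
  defines "n \<equiv> (r - 1) * m"
  shows "{N. balanced_perfect_matching (parts r n) (delete_edges (K r n) M) N} =
    {N \<in> colouring.matchings fst {..<r} ({..<r} \<times> {..<n}) (\<lambda>_. m). N \<inter> M = {}}"
proof -
  interpret colouring "fst :: nat \<times> nat \<Rightarrow> nat" "{..<r}"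
    by unfold_locales simp
  define V where "V = {..<r} \<times> {..<n}"
  have n: "n > 0" using assms by (simp add: n_def)
  have V: "finite V" "fst ` V \<subseteq> {..<r}" by (auto simp: V_def)
  have verts: "vertices (K r n) = V"
    by (auto simp: K_def complete_multipartite_def parts_def V_def)
  have bichromatic_iff: "bichromatic e \<longleftrightarrow> (\<exists>u v. e = {u, v} \<and> fst u \<noteq> fst v)"
    for e :: "(nat \<times> nat) set"
    using bichromatic_pair by (metis bichromatic_def card_2_iff)
  have edges: "edges (K r n) = {e. e \<subseteq> V \<and> bichromatic e}"
  proof (intro equalityI subsetI)
    fix e assume "e \<in> edges (K r n)"
    then show "e \<in> {e. e \<subseteq> V \<and> bichromatic e}"
      by (force simp: K_def complete_multipartite_def parts_def V_def bichromatic_pair)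
  next
    fix e assume "e \<in> {e. e \<subseteq> V \<and> bichromatic e}"
    then obtain u v where e: "e = {u, v}" "fst u \<noteq> fst v" "u \<in> V" "v \<in> V"
      by (auto simp: bichromatic_iff)
    have "{fst u} \<times> {..<n} \<in> parts r n" "{fst v} \<times> {..<n} \<in> parts r n"
      "u \<in> {fst u} \<times> {..<n}" "v \<in> {fst v} \<times> {..<n}"
      using e by (auto simp: parts_def V_def)
    moreover have "{fst u} \<times> {..<n} \<noteq> {fst v} \<times> {..<n}" using e n by (auto simp: times_eq_iff)
    ultimately show "e \<in> edges (K r n)"
      unfolding K_def complete_multipartite_def graph.select_convs mem_Collect_eq
      using e(1) by metis
  qed
  have perfect: "perfect_matching (delete_edges (K r n) M) N \<longleftrightarrow>
      partition_on V N \<and> (\<forall>e\<in>N. bichromatic e) \<and> N \<inter> M = {}" for N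
  proof (cases "(\<forall>e\<in>N. e \<subseteq> V \<and> bichromatic e) \<and> N \<inter> M = {}")
    case True
    then have "\<Union>N \<subseteq> V" "{} \<notin> N" by (auto simp: bichromatic_def)
    then have "partition_on V N \<longleftrightarrow> (\<forall>v\<in>V. \<exists>!e. e \<in> N \<and> v \<in> e)"
      by (rule partition_on_iff_ex1)
    moreover have "N \<subseteq> edges (K r n) - M" using True edges by auto
    ultimately show ?thesis
      using True by (simp add: perfect_matching_def delete_edges_def verts)
  next
    \<comment> \<open>Either side forces the edges of \<open>N\<close> to be bichromatic, inside
      \<open>V\<close> and outside \<open>M\<close>, so both sides fail.\<close>
    case False
    then show ?thesis
      by (auto simp: perfect_matching_def delete_edges_def edges partition_on_def)
  qed
  have between: "edges_between N ({i} \<times> {..<n}) ({j} \<times> {..<n}) = {e \<in> N. fst ` e = {i, j}}"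
    if "\<Union>N \<subseteq> V" "\<forall>e\<in>N. bichromatic e" "i \<noteq> j" for N i j
  proof (intro equalityI subsetI)
    fix e assume "e \<in> edges_between N ({i} \<times> {..<n}) ({j} \<times> {..<n})"
    then show "e \<in> {e \<in> N. fst ` e = {i, j}}" by (auto simp: edges_between_def)
  next
    fix e assume e: "e \<in> {e \<in> N. fst ` e = {i, j}}"
    then have "bichromatic e" "e \<subseteq> V" using that(1,2) by auto
    then obtain u v where uv: "e = {u, v}" "u \<in> V" "v \<in> V"
      by (auto simp: bichromatic_iff)
    \<comment> \<open>The edge is unordered, so either endpoint may be the one in class
      \<open>i\<close>.\<close>
    with e have "fst u = i \<and> fst v = j \<or> fst v = i \<and> fst u = j"
      by (auto simp: doubleton_eq_iff)
    then obtain u' v' where "e = {u', v'}" "u' \<in> {i} \<times> {..<n}" "v' \<in> {j} \<times> {..<n}"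
      using uv by (fastforce simp: V_def insert_commute)
    then show "e \<in> edges_between N ({i} \<times> {..<n}) ({j} \<times> {..<n})"
      using e by (auto simp: edges_between_def)
  qed
  have bal: "balanced (parts r n) N \<longleftrightarrow> (\<exists>k. \<forall>T\<in>pairs. count_type N T = k)"
    if N: "\<Union>N \<subseteq> V" "\<forall>e\<in>N. bichromatic e" for N
  proof -
    have "(\<forall>A\<in>parts r n. \<forall>B\<in>parts r n. A \<noteq> B \<longrightarrow> card (edges_between N A B) = k) \<longleftrightarrow>
        (\<forall>i\<in>{..<r}. \<forall>j\<in>{..<r}. i \<noteq> j \<longrightarrow> count_type N {i, j} = k)" for k
    proof -
      \<comment> \<open>Nonempty classes are distinct for distinct indices, so pairs of distinct
        classes correspond to pairs of distinct colours.\<close>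
      have "{i} \<times> {..<n} = {j} \<times> {..<n} \<longleftrightarrow> i = j" for i j :: nat
        using n by (auto simp: times_eq_iff)
      then show ?thesis
        by (simp add: parts_def count_type_def between[OF N])
    qed
    also have "\<dots> k \<longleftrightarrow> (\<forall>T\<in>pairs. count_type N T = k)" for k
    proof (intro iffI ballI impI)
      fix T
      assume *: "\<forall>i\<in>{..<r}. \<forall>j\<in>{..<r}. i \<noteq> j \<longrightarrow> count_type N {i, j} = k" and "T \<in> pairs"
      then obtain i j where "T = {i, j}" "i \<noteq> j" "i \<in> {..<r}" "j \<in> {..<r}"
        by (auto simp: pairs_def card_2_iff)
      with * show "count_type N T = k" by simp
    next
      fix i j
      assume *: "\<forall>T\<in>pairs. count_type N T = k" and "i \<in> {..<r}" "j \<in> {..<r}" "i \<noteq> j"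
      then have "{i, j} \<in> pairs" by (simp add: pairs_def)
      with * show "count_type N {i, j} = k" by simp
    qed
    finally show ?thesis by (simp add: balanced_def)
  qed
  \<comment> \<open>Class 0 has \<open>(r - 1) * m\<close> vertices and meets \<open>r - 1\<close>
    pairs, each with \<open>k\<close> edges.\<close>
  have k_eq_m: "k = m" if N: "N \<in> matchings V (\<lambda>_. k)" for N k
  proof -
    have 0: "0 \<in> {..<r}" using assms by simp
    have "colour_class V 0 = {0} \<times> {..<n}" using 0 by (auto simp: colour_class_def V_def)
    then have "card {T\<in>pairs. 0 \<in> T} * k = n"
      using sum_count_type_incident[OF V N, of 0] by simp
    moreover have "card {T\<in>pairs. 0 \<in> T} = r - 1"
      using bij_betw_same_card[OF bij_betw_incident_pairs[OF 0]] 0 by simp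
    ultimately show ?thesis using assms by (simp add: n_def)
  qed
  have "balanced_perfect_matching (parts r n) (delete_edges (K r n) M) N \<longleftrightarrow>
      N \<in> matchings V (\<lambda>_. m) \<and> N \<inter> M = {}" for N
  proof -
    have "balanced_perfect_matching (parts r n) (delete_edges (K r n) M) N \<longleftrightarrow>
        (\<exists>k. N \<in> matchings V (\<lambda>_. k)) \<and> N \<inter> M = {}"
    proof (cases "partition_on V N \<and> (\<forall>e\<in>N. bichromatic e)")
      case True
      then have "\<Union>N \<subseteq> V" by (simp add: partition_on_def)
      from bal[OF this] True show ?thesis
        by (simp add: balanced_perfect_matching_def perfect matchings_def conj_commute)
    next
      case False
      then show ?thesis
        unfolding balanced_perfect_matching_def perfect matchings_def by blast
    qed
    then show ?thesis using k_eq_m by metis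
  qed
  then show ?thesis by (simp add: V_def)
qed

section \<open>The Poisson limit\<close>

theorem theorem6:
  fixes r :: nat and M :: "nat \<Rightarrow> (nat \<times> nat) set set"
  assumes "r \<ge> 3"
    and "\<And>m. m \<ge> 1 \<Longrightarrow>
      balanced_perfect_matching (parts r ((r - 1) * m)) (K r ((r - 1) * m)) (M m)"
  shows "(\<lambda>m. real (bpm (parts r ((r - 1) * m)) (delete_edges (K r ((r - 1) * m)) (M m)))
            / real (bpm (parts r ((r - 1) * m)) (K r ((r - 1) * m))))
         \<longlonglongrightarrow> exp (- (real r / (2 * real r - 2)))"
proof -
  interpret colouring "fst :: nat \<times> nat \<Rightarrow> nat" "{..<r}"
    by unfold_locales simp
  define n where "n m = (r - 1) * m" for m
  define V where "V m = {..<r} \<times> {..<n m}" for m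
  define F where "F m = matchings (V m) (\<lambda>_. m)" for m
  define a where "a = r choose 2"
  define l where "l = real r / (2 * real r - 2)"
  \<comment> \<open>For a uniformly random member \<open>N\<close> of \<open>F m\<close>,
    \<open>p m\<close> is the probability of avoiding \<open>M m\<close>, and \<open>b k m\<close>
    is the \<open>k\<close>-th binomial moment of the size of \<open>N \<inter> M m\<close>.\<close>
  define p where "p m = real (card {N \<in> F m. N \<inter> M m = {}}) / real (card (F m))" for m
  define b where "b k m = (\<Sum>N\<in>F m. real (card (N \<inter> M m) choose k)) / real (card (F m))" for k m
  have V: "finite (V m)" "fst ` V m \<subseteq> {..<r}" for m by (auto simp: V_def)
  have finF: "finite (F m)" for m unfolding F_def using V(1) by (rule finite_matchings)
  have bpm_delete: "{N. balanced_perfect_matching (parts r (n m)) (delete_edges (K r (n m)) M') N} =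
      {N \<in> F m. N \<inter> M' = {}}" if "m \<ge> 1" for m M'
    using balanced_matchings_eq[of r m M'] that assms(1) by (simp add: n_def F_def V_def)
  have bpm_all: "{N. balanced_perfect_matching (parts r (n m)) (K r (n m)) N} = F m" if "m \<ge> 1" for m
  proof -
    have "delete_edges (K r (n m)) {} = K r (n m)" by (simp add: delete_edges_def)
    then show ?thesis using bpm_delete[OF that, of "{}"] by simp
  qed
  have MF: "M m \<in> F m" if "m \<ge> 1" for m
    using bpm_all[OF that] assms(2)[OF that] by (auto simp: n_def)
  have Fpos: "card (F m) > 0" if "m \<ge> 1" for m
    using MF[OF that] finF by (auto simp: card_gt_0_iff)
  have finM: "finite (M m)" if "m \<ge> 1" for m
    using MF[OF that] V finite_matching unfolding F_def by blast
  have cardM: "card (M m) = a * m" if m: "m \<ge> 1" for m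
  proof -
    have M: "partition_on (V m) (M m)" "\<forall>e\<in>M m. bichromatic e" "\<forall>T\<in>pairs. count_type (M m) T = m"
      using MF[OF m] by (auto simp: F_def matchings_def)
    have "card (M m) = (\<Sum>T\<in>pairs. count_type (M m) T)"
      using sum_count_type[of "M m" "V m" "\<lambda>_. True"] finM[OF m] M V by (simp add: partition_on_def)
    then show ?thesis using M(3) by (simp add: card_pairs a_def)
  qed
  have card_class: "card (colour_class (V m) i) = n m" if "i \<in> {..<r}" for i m
  proof -
    have "colour_class (V m) i = {i} \<times> {..<n m}" using that by (auto simp: colour_class_def V_def)
    then show ?thesis by simp
  qed
  have b_eq: "b k m = (\<Sum>S\<in>{S. S \<subseteq> M m \<and> card S = k}.
      real (card {N \<in> F m. S \<subseteq> N}) / real (card (F m)))" if "m \<ge> 1" for k m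
    using sum_binomial_Int[OF finF[of m] finM[OF that], of k]
    by (simp add: b_def sum_divide_distrib[symmetric] flip: of_nat_sum)
  \<comment> \<open>The moment is a sum over all \<open>k\<close>-subsets of \<open>M m\<close>, and
    each term obeys the same two bounds.\<close>
  have bounds: "real (a * m choose k) * ((real m - real k) ^ k / real (n m) ^ (2 * k)) \<le> b k m"
    "b k m \<le> real (a * m choose k) * (real m ^ k / (real (n m) - real k) ^ (2 * k))"
    if m: "m \<ge> 1" "m > k" for m k
  proof -
    have n: "k < n m"
    proof -
      have "1 * m \<le> (r - 1) * m" using assms(1) by (intro mult_right_mono) auto
      then show ?thesis using m(2) unfolding n_def by linarith
    qed
    have card: "card {S. S \<subseteq> M m \<and> card S = k} = a * m choose k"
      using n_subsets[OF finM[OF m(1)]] cardM[OF m(1)] by simp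
    note pb = prob_containing_bounds[OF V MF[OF m(1), unfolded F_def] card_class _ _ _ n, folded F_def]
    show "real (a * m choose k) * ((real m - real k) ^ k / real (n m) ^ (2 * k)) \<le> b k m"
      unfolding b_eq[OF m(1)] card[symmetric]
      using pb(1) m by (intro sum_bounded_below) auto
    show "b k m \<le> real (a * m choose k) * (real m ^ k / (real (n m) - real k) ^ (2 * k))"
      unfolding b_eq[OF m(1)] card[symmetric]
      using pb(2) m by (intro sum_bounded_above) auto
  qed
  have b_tendsto: "b k \<longlonglongrightarrow> l ^ k / fact k" for k
  proof -
    define q where "q = real r - 1"
    have q: "q > 0" "real (n m) = q * real m" for m using assms(1) by (auto simp: q_def n_def of_nat_diff)
    have lim0: "(\<lambda>m. real k / real m) \<longlonglongrightarrow> 0" by (rule lim_const_over_n)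
    \<comment> \<open>With \<open>a = r * q / 2\<close> one gets \<open>l = a / q ^ 2\<close>: there
      are \<open>a * m\<close> edges, each hit with probability about \<open>m / n ^ 2\<close>, that
      is \<open>1 / (q ^ 2 * m)\<close>. The terms \<open>1 - 0\<close> and \<open>q - 0\<close>
      have the shape that the limit rules produce below.\<close>
    have l: "l ^ k / fact k = (real a ^ k / fact k) * (1 - 0) ^ k * (1 / q) ^ (2 * k)"
      "l ^ k / fact k = (real a ^ k / fact k) * (1 / (q - 0)) ^ (2 * k)"
    proof -
      have "real a = real r * q / 2"
        using assms(1) by (simp add: a_def choose_two real_of_nat_div q_def of_nat_diff)
      moreover have "2 * real r - 2 = 2 * q" by (simp add: q_def)
      ultimately have "l = real a * (1 / q) ^ 2"
        unfolding l_def using q(1) by (simp add: power2_eq_square field_simps)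
      then show "l ^ k / fact k = (real a ^ k / fact k) * (1 - 0) ^ k * (1 / q) ^ (2 * k)"
        "l ^ k / fact k = (real a ^ k / fact k) * (1 / (q - 0)) ^ (2 * k)"
        by (simp_all add: power_mult_distrib power_mult power_divide)
    qed
    show ?thesis
    proof (rule tendsto_sandwich)
      show "(\<lambda>m. real (a * m choose k) / real m ^ k * (1 - real k / real m) ^ k * (1 / q) ^ (2 * k))
          \<longlonglongrightarrow> l ^ k / fact k"
        unfolding l(1) by (intro tendsto_intros binomial_over_power_tendsto lim0)
      show "(\<lambda>m. real (a * m choose k) / real m ^ k * (1 / (q - real k / real m)) ^ (2 * k))
          \<longlonglongrightarrow> l ^ k / fact k"
        unfolding l(2) using q(1) by (intro tendsto_intros binomial_over_power_tendsto lim0) auto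
      have "eventually (\<lambda>m. m > k) sequentially" by (rule eventually_gt_at_top)
      then show "eventually (\<lambda>m. real (a * m choose k) / real m ^ k * (1 - real k / real m) ^ k *
          (1 / q) ^ (2 * k) \<le> b k m) sequentially"
      proof eventually_elim
        \<comment> \<open>The powers of \<open>m\<close> balance: \<open>m ^ k\<close> from the
          number of subsets and \<open>m ^ k\<close> from the multiplicities cancel
          \<open>m ^ (2 * k)\<close> from the class sizes.\<close>
        case (elim m)
        have "(1 - real k / real m) = (real m - real k) / real m" using elim by (simp add: field_simps)
        then have "real (a * m choose k) / real m ^ k * (1 - real k / real m) ^ k * (1 / q) ^ (2 * k) =
            real (a * m choose k) * ((real m - real k) ^ k / real (n m) ^ (2 * k))"
          using elim q by (simp add: power_divide power_mult_distrib power_mult power2_eq_square)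
        then show ?case using bounds(1)[of m k] elim by simp
      qed
      have "eventually (\<lambda>m. m > k) sequentially" by (rule eventually_gt_at_top)
      then show "eventually (\<lambda>m. b k m \<le> real (a * m choose k) / real m ^ k *
          (1 / (q - real k / real m)) ^ (2 * k)) sequentially"
      proof eventually_elim
        case (elim m)
        have "1 / (q - real k / real m) = real m / (real (n m) - real k)"
          using elim by (simp add: q(2) field_simps)
        then have "real (a * m choose k) / real m ^ k * (1 / (q - real k / real m)) ^ (2 * k) =
            real (a * m choose k) * (real m ^ k / (real (n m) - real k) ^ (2 * k))"
          using elim by (simp add: power_divide power_mult power2_eq_square power_mult_distrib)
        then show ?case using bounds(2)[of m k] elim by simp
      qed
    qed
  qed
  have alt: "(\<Sum>k\<le>L. (- 1) ^ k * b k m) =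
      (\<Sum>k\<le>L. (- 1) ^ k * (\<Sum>N\<in>F m. real (card (N \<inter> M m) choose k))) / real (card (F m))" for L m
    unfolding b_def by (subst sum_divide_distrib) simp
  \<comment> \<open>Since \<open>M m\<close> is finite, a zero cardinality of the intersection does
    mean that it is empty.\<close>
  have p_eq: "p m = real (card {N \<in> F m. card (N \<inter> M m) = 0}) / real (card (F m))" if "m \<ge> 1" for m
    using finM[OF that] by (simp add: p_def)
  have "eventually (\<lambda>m. p m \<le> (\<Sum>k\<le>L. (- 1) ^ k * b k m)) sequentially" if "even L" for L
    using eventually_ge_at_top[of 1]
    by eventually_elim
      (simp add: p_eq alt divide_right_mono bonferroni(1)[OF finF that])
  moreover have "eventually (\<lambda>m. p m \<ge> (\<Sum>k\<le>L. (- 1) ^ k * b k m)) sequentially" if "odd L" for L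
    using eventually_ge_at_top[of 1]
    by eventually_elim
      (simp add: p_eq alt divide_right_mono bonferroni(2)[OF finF that])
  ultimately have "p \<longlonglongrightarrow> exp (- l)" by (rule tendsto_exp_minus_sieve[OF b_tendsto])
  \<comment> \<open>The identification with \<open>bpm\<close> holds from \<open>m = 1\<close> on,
    which is enough for the limit.\<close>
  moreover have "eventually (\<lambda>m. p m = real (bpm (parts r ((r - 1) * m)) (delete_edges (K r ((r - 1) * m)) (M m)))
      / real (bpm (parts r ((r - 1) * m)) (K r ((r - 1) * m)))) sequentially"
    using eventually_ge_at_top[of 1]
    by eventually_elim
      (simp only: bpm_def bpm_delete[unfolded n_def] bpm_all[unfolded n_def] p_def)
  ultimately show ?thesis unfolding l_def by (rule Lim_transform_eventually)
qed

end
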